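(* Let $\Sigma_1=(X_1,X_{1,0},S_1,U,\to_1,Y,h_1)$ and $\Sigma_2=(X_2,X_{2,0},S_2,U,\to_2,Y,h_2)$ be NTSs with common input set $U$ and output set $Y$. If there exists an InfSOP bisimulation relation $\sim\subseteq X_1\times X_2$ between $\Sigma_1$ and $\Sigma_2$, then $\Sigma_1$ is infinite-step opaque if and only if $\Sigma_2$ is infinite-step opaque.
   Context: A nondeterministic transition system (NTS) is a tuple $\Sigma=(X,X_0,S,U,\to,Y,h)$, where $X$ is a (possibly infinite) set of states, $X_0\subseteq X$ the initial states, $S\subseteq X$ the secret states, $U$ a (possibly infinite) set of inputs, $\to\subseteq X\times U\times X$ the transition relation (write $x\xrightarrow{u}x'$ for $(x,u,x')\in\to$), $Y$ a set of outputs and $h:X\to Y$ the output map. $U^*$ is the set of finite sequences $\alpha=\alpha(0)\cdots\alpha(|\alpha|-1)$ over $U$, including the empty one. For $\alpha\in U^*$, a run over $\alpha$ is a nonempty sequence of states $x_0x_1\dots x_k$ with $k\le|\alpha|$, $x_0\in X_0$ and $(x_j,\alpha(j),x_{j+1})\in\to$ for all $j\in\{0,\dots,k-1\}$; it is maximal if $k=|\alpha|$ or there is no $x'$ with $(x_k,\alpha(k),x')\in\to$. $\Sigma$ is infinite-step opaque if for every $\alpha\in U^*$, every maximal run $x_0\dots x_k$ over $\alpha$ and every $i\in\{0,\dots,k\}$ with $x_i\in S$, there is a maximal run $x_0'\dots x_k'$ over $\alpha$ with $x_i'\notin S$ and $h(x_j)=h(x_j')$ for all $j\in\{0,\dots,k\}$.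 A relation $\sim\subseteq X_1\times X_2$ is an InfSOP (infinite-step opacity-preserving) bisimulation relation between $\Sigma_1$ and $\Sigma_2$ if: (1a) for every $x_{1,0}\in X_{1,0}\cap S_1$ there is $x_{2,0}\in X_{2,0}\cap S_2$ with $(x_{1,0},x_{2,0})\in\sim$; (1b) for every $x_{1,0}\in X_{1,0}\setminus S_1$ there is $x_{2,0}\in X_{2,0}\setminus S_2$ with $(x_{1,0},x_{2,0})\in\sim$; (1c) for every $x_{2,0}\in X_{2,0}\cap S_2$ there is $x_{1,0}\in X_{1,0}\cap S_1$ with $(x_{1,0},x_{2,0})\in\sim$; (1d) for every $x_{2,0}\in X_{2,0}\setminus S_2$ there is $x_{1,0}\in X_{1,0}\setminus S_1$ with $(x_{1,0},x_{2,0})\in\sim$; (2) $h_1(x_1)=h_2(x_2)$ for all $(x_1,x_2)\in\sim$; (3) for every $(x_1,x_2)\in\sim$ and every $u\in U$: (a) for every transition $x_1\xrightarrow{u}_1x_1'$ with $x_1'\in S_1$ there is a transition $x_2\xrightarrow{u}_2x_2'$ with $x_2'\in S_2$ and $(x_1',x_2')\in\sim$; (b) for every $x_1\xrightarrow{u}_1x_1'$ with $x_1'\in X_1\setminus S_1$ there is $x_2\xrightarrow{u}_2x_2'$ with $x_2'\in X_2\setminus S_2$ and $(x_1',x_2')\in\sim$; (c) for every $x_2\xrightarrow{u}_2x_2'$ with $x_2'\in S_2$ there is $x_1\xrightarrow{u}_1x_1'$ with $x_1'\in S_1$ and $(x_1',x_2')\in\sim$; (d) for every $x_2\xrightarrow{u}_2x_2'$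 with $x_2'\in X_2\setminus S_2$ there is $x_1\xrightarrow{u}_1x_1'$ with $x_1'\in X_1\setminus S_1$ and $(x_1',x_2')\in\sim$. *)

theory Defs
  imports Main
begin

record ('x, 'u, 'y) nts =
  states  :: "'x set"
  init    :: "'x set"
  secret  :: "'x set"
  inputs  :: "'u set"
  trans   :: "('x \<times> 'u \<times> 'x) set"
  outputs :: "'y set"
  outmap  :: "'x \<Rightarrow> 'y"

text \<open>The output map is a total HOL function; only its values on the states are meaningful.\<close>

definition is_nts :: "('x, 'u, 'y) nts \<Rightarrow> bool" where
  "is_nts \<Sigma> \<longleftrightarrow>
     init \<Sigma> \<subseteq> states \<Sigma> \<and>
     secret \<Sigma> \<subseteq> states \<Sigma> \<and>
     trans \<Sigma> \<subseteq> states \<Sigma> \<times> inputs \<Sigma> \<times> states \<Sigma> \<and>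
     outmap \<Sigma> ` states \<Sigma> \<subseteq> outputs \<Sigma>"

text \<open>A run $x_0 \dots x_k$ is the list of its $k + 1$ states.\<close>

definition run_over :: "('x, 'u, 'y) nts \<Rightarrow> 'u list \<Rightarrow> nat \<Rightarrow> 'x list \<Rightarrow> bool" where
  "run_over \<Sigma> \<alpha> k xs \<longleftrightarrow>
     length xs = k + 1 \<and> set xs \<subseteq> states \<Sigma> \<and> k \<le> length \<alpha> \<and>
     xs ! 0 \<in> init \<Sigma> \<and>
     (\<forall>j<k. (xs ! j, \<alpha> ! j, xs ! (j + 1)) \<in> trans \<Sigma>)"

definition maximal_run_over :: "('x, 'u, 'y) nts \<Rightarrow> 'u list \<Rightarrow> nat \<Rightarrow> 'x list \<Rightarrow> bool" where
  "maximal_run_over \<Sigma> \<alpha> k xs \<longleftrightarrow>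
     run_over \<Sigma> \<alpha> k xs \<and>
     (k = length \<alpha> \<or> \<not> (\<exists>x'. (xs ! k, \<alpha> ! k, x') \<in> trans \<Sigma>))"

definition infinite_step_opaque :: "('x, 'u, 'y) nts \<Rightarrow> bool" where
  "infinite_step_opaque \<Sigma> \<longleftrightarrow>
     (\<forall>\<alpha> \<in> lists (inputs \<Sigma>). \<forall>k xs. maximal_run_over \<Sigma> \<alpha> k xs \<longrightarrow>
       (\<forall>i\<le>k. xs ! i \<in> secret \<Sigma> \<longrightarrow>
         (\<exists>xs'. maximal_run_over \<Sigma> \<alpha> k xs' \<and> xs' ! i \<notin> secret \<Sigma> \<and>
           (\<forall>j\<le>k. outmap \<Sigma> (xs ! j) = outmap \<Sigma> (xs' ! j)))))"

text \<open>The inputs in the transfer conditions range over the inputs of the first system; the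
  notion is meant for two systems with the same inputs.\<close>

definition InfSOP_bisimulation ::
    "('x1, 'u, 'y) nts \<Rightarrow> ('x2, 'u, 'y) nts \<Rightarrow> ('x1 \<times> 'x2) set \<Rightarrow> bool" where
  "InfSOP_bisimulation \<Sigma>1 \<Sigma>2 R \<longleftrightarrow>
     R \<subseteq> states \<Sigma>1 \<times> states \<Sigma>2 \<and>
     (\<forall>x1 \<in> init \<Sigma>1 \<inter> secret \<Sigma>1. \<exists>x2 \<in> init \<Sigma>2 \<inter> secret \<Sigma>2. (x1, x2) \<in> R) \<and>
     (\<forall>x1 \<in> init \<Sigma>1 - secret \<Sigma>1. \<exists>x2 \<in> init \<Sigma>2 - secret \<Sigma>2. (x1, x2) \<in> R) \<and>
     (\<forall>x2 \<in> init \<Sigma>2 \<inter> secret \<Sigma>2. \<exists>x1 \<in> init \<Sigma>1 \<inter> secret \<Sigma>1. (x1, x2) \<in> R) \<and>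
     (\<forall>x2 \<in> init \<Sigma>2 - secret \<Sigma>2. \<exists>x1 \<in> init \<Sigma>1 - secret \<Sigma>1. (x1, x2) \<in> R) \<and>
     (\<forall>(x1, x2) \<in> R. outmap \<Sigma>1 x1 = outmap \<Sigma>2 x2) \<and>
     (\<forall>(x1, x2) \<in> R. \<forall>u \<in> inputs \<Sigma>1.
       (\<forall>x1' \<in> secret \<Sigma>1. (x1, u, x1') \<in> trans \<Sigma>1 \<longrightarrow>
         (\<exists>x2' \<in> secret \<Sigma>2. (x2, u, x2') \<in> trans \<Sigma>2 \<and> (x1', x2') \<in> R)) \<and>
       (\<forall>x1' \<in> states \<Sigma>1 - secret \<Sigma>1. (x1, u, x1') \<in> trans \<Sigma>1 \<longrightarrow>
         (\<exists>x2' \<in> states \<Sigma>2 - secret \<Sigma>2. (x2, u, x2') \<in> trans \<Sigma>2 \<and> (x1', x2') \<in> R)) \<and>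
       (\<forall>x2' \<in> secret \<Sigma>2. (x2, u, x2') \<in> trans \<Sigma>2 \<longrightarrow>
         (\<exists>x1' \<in> secret \<Sigma>1. (x1, u, x1') \<in> trans \<Sigma>1 \<and> (x1', x2') \<in> R)) \<and>
       (\<forall>x2' \<in> states \<Sigma>2 - secret \<Sigma>2. (x2, u, x2') \<in> trans \<Sigma>2 \<longrightarrow>
         (\<exists>x1' \<in> states \<Sigma>1 - secret \<Sigma>1. (x1, u, x1') \<in> trans \<Sigma>1 \<and> (x1', x2') \<in> R)))"

end

theory Submission
  imports Defs
begin

text \<open>
  A bisimulation lifts every run of one system, step by step, to a run of the other system whose
  states are pointwise related and have the same secrecy status; related states enable the same
  inputs, so maximality is preserved as well. Given a maximal run visiting a secret state of the
  second system, one lifts it to the first system, uses opacity there to obtain a run with the same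
  outputs that is not secret at that instant, and lifts that run back.
\<close>

text \<open>Lets each one-directional lemma below be used from the second system back to the first.
  The clauses come in mirrored pairs; the one asymmetry is that \<open>u\<close> ranges over the
  inputs of the first system, which equality of the input sets repairs.\<close>

lemma InfSOP_bisimulation_converse:
  assumes "InfSOP_bisimulation \<Sigma>1 \<Sigma>2 R" and "inputs \<Sigma>1 = inputs \<Sigma>2"
  shows "InfSOP_bisimulation \<Sigma>2 \<Sigma>1 (R\<inverse>)"
proof -
  \<comment> \<open>These three equivalences remove the converse and reorient the output equation.
    What remains differs from the original only in the order of its conjuncts, which
    \<open>conj_ac\<close> absorbs.\<close>
  have "R\<inverse> \<subseteq> A \<times> B \<longleftrightarrow> R \<subseteq> B \<times> A" for A B
    by auto
  moreover have "(\<forall>(y, x) \<in> R\<inverse>. P y x) \<longleftrightarrow> (\<forall>(x, y) \<in> R. P y x)" for P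
    by auto
  moreover have "(\<forall>(x, y) \<in> R. outmap \<Sigma>2 y = outmap \<Sigma>1 x) \<longleftrightarrow>
      (\<forall>(x, y) \<in> R. outmap \<Sigma>1 x = outmap \<Sigma>2 y)"
    by (simp only: eq_commute)
  ultimately have "InfSOP_bisimulation \<Sigma>2 \<Sigma>1 (R\<inverse>) \<longleftrightarrow> InfSOP_bisimulation \<Sigma>1 \<Sigma>2 R"
    by (simp only: InfSOP_bisimulation_def assms(2) converse_iff conj_ac)
  then show ?thesis
    using assms(1) by blast
qed

lemma InfSOP_bisimulation_init:
  assumes "InfSOP_bisimulation \<Sigma>1 \<Sigma>2 R" and "x \<in> init \<Sigma>1"
  obtains y where "y \<in> init \<Sigma>2" "(x, y) \<in> R" "x \<in> secret \<Sigma>1 \<longleftrightarrow> y \<in> secret \<Sigma>2"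
  using assms unfolding InfSOP_bisimulation_def by (cases "x \<in> secret \<Sigma>1") blast+

text \<open>The transfer clauses speak only of \<open>u\<close> in \<open>inputs \<Sigma>1\<close>
  and of successors in \<open>states \<Sigma>1\<close>; well-formedness of \<open>\<Sigma>1\<close>
  supplies both. The secret and non-secret clauses then merge into one equivalence.\<close>

lemma InfSOP_bisimulation_step:
  assumes bisim: "InfSOP_bisimulation \<Sigma>1 \<Sigma>2 R" and nts: "is_nts \<Sigma>1"
    and xy: "(x, y) \<in> R" and step: "(x, u, x') \<in> trans \<Sigma>1"
  obtains y' where "(y, u, y') \<in> trans \<Sigma>2" "(x', y') \<in> R" "x' \<in> secret \<Sigma>1 \<longleftrightarrow> y' \<in> secret \<Sigma>2"
proof -
  have "u \<in> inputs \<Sigma>1" "x' \<in> states \<Sigma>1"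
    using nts step by (auto simp: is_nts_def)
  then have "\<exists>y'. (y, u, y') \<in> trans \<Sigma>2 \<and> (x', y') \<in> R \<and> (x' \<in> secret \<Sigma>1 \<longleftrightarrow> y' \<in> secret \<Sigma>2)"
    using bisim xy step unfolding InfSOP_bisimulation_def
    by (cases "x' \<in> secret \<Sigma>1") blast+
  then show thesis using that by blast
qed

text \<open>Induction on the length of the run. Maximality is left out because a proper prefix of a
  maximal run is never maximal.\<close>

lemma InfSOP_bisimulation_run:
  assumes bisim: "InfSOP_bisimulation \<Sigma>1 \<Sigma>2 R" and nts: "is_nts \<Sigma>1"
    and "run_over \<Sigma>1 \<alpha> k xs"
  shows "\<exists>ys. run_over \<Sigma>2 \<alpha> k ys \<and>
    (\<forall>j\<le>k. (xs ! j, ys ! j) \<in> R \<and> (xs ! j \<in> secret \<Sigma>1 \<longleftrightarrow> ys ! j \<in> secret \<Sigma>2))"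
  using assms(3)
proof (induction k arbitrary: xs)
  case 0
  then have "xs ! 0 \<in> init \<Sigma>1" by (simp add: run_over_def)
  then obtain y where y: "y \<in> init \<Sigma>2" "(xs ! 0, y) \<in> R" "xs ! 0 \<in> secret \<Sigma>1 \<longleftrightarrow> y \<in> secret \<Sigma>2"
    using InfSOP_bisimulation_init[OF bisim] by blast
  moreover have "y \<in> states \<Sigma>2"
    using bisim y(2) unfolding InfSOP_bisimulation_def by blast
  ultimately show ?case by (intro exI[of _ "[y]"]) (simp add: run_over_def)
next
  case (Suc k)
  \<comment> \<open>The run without its last state is matched by the induction hypothesis; the last
    transition is then matched separately and its target appended.\<close>
  have "run_over \<Sigma>1 \<alpha> k (butlast xs)"
    using Suc.prems by (auto simp: run_over_def nth_butlast dest: in_set_butlastD)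
  from Suc.IH[OF this] obtain ys where ys: "run_over \<Sigma>2 \<alpha> k ys"
    and rel: "\<forall>j\<le>k. (butlast xs ! j, ys ! j) \<in> R \<and>
      (butlast xs ! j \<in> secret \<Sigma>1 \<longleftrightarrow> ys ! j \<in> secret \<Sigma>2)"
    by blast
  have len: "length xs = k + 2" "length ys = k + 1"
    using Suc.prems ys by (auto simp: run_over_def)
  have rel': "(xs ! j, ys ! j) \<in> R \<and> (xs ! j \<in> secret \<Sigma>1 \<longleftrightarrow> ys ! j \<in> secret \<Sigma>2)" if "j \<le> k" for j
    using rel that len by (simp add: nth_butlast)
  have "(xs ! k, \<alpha> ! k, xs ! Suc k) \<in> trans \<Sigma>1"
    using Suc.prems by (simp add: run_over_def)
  then obtain y where y: "(ys ! k, \<alpha> ! k, y) \<in> trans \<Sigma>2" "(xs ! Suc k, y) \<in> R"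
      "xs ! Suc k \<in> secret \<Sigma>1 \<longleftrightarrow> y \<in> secret \<Sigma>2"
    using InfSOP_bisimulation_step[OF bisim nts] rel' by blast
  have "y \<in> states \<Sigma>2"
    using bisim y(2) unfolding InfSOP_bisimulation_def by blast
  then have "run_over \<Sigma>2 \<alpha> (Suc k) (ys @ [y])"
    using ys y(1) Suc.prems len
    by (auto simp: run_over_def nth_append less_Suc_eq)
  moreover have "(xs ! j, (ys @ [y]) ! j) \<in> R \<and>
      (xs ! j \<in> secret \<Sigma>1 \<longleftrightarrow> (ys @ [y]) ! j \<in> secret \<Sigma>2)" if "j \<le> Suc k" for j
    using that rel' y(2,3) len by (cases "j = Suc k") (auto simp: nth_append)
  ultimately show ?case by blast
qed

lemma InfSOP_bisimulation_maximal_run: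
  assumes bisim: "InfSOP_bisimulation \<Sigma>1 \<Sigma>2 R" and nts: "is_nts \<Sigma>1" "is_nts \<Sigma>2"
    and inputs: "inputs \<Sigma>1 = inputs \<Sigma>2" and max: "maximal_run_over \<Sigma>1 \<alpha> k xs"
  obtains ys where "maximal_run_over \<Sigma>2 \<alpha> k ys"
    "\<And>j. j \<le> k \<Longrightarrow> outmap \<Sigma>1 (xs ! j) = outmap \<Sigma>2 (ys ! j)"
    "\<And>j. j \<le> k \<Longrightarrow> xs ! j \<in> secret \<Sigma>1 \<longleftrightarrow> ys ! j \<in> secret \<Sigma>2"
proof -
  have "run_over \<Sigma>1 \<alpha> k xs"
    using max by (simp add: maximal_run_over_def)
  then obtain ys where ys: "run_over \<Sigma>2 \<alpha> k ys"
    and rel: "\<And>j. j \<le> k \<Longrightarrow> (xs ! j, ys ! j) \<in> R"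
    and sec: "\<And>j. j \<le> k \<Longrightarrow> xs ! j \<in> secret \<Sigma>1 \<longleftrightarrow> ys ! j \<in> secret \<Sigma>2"
    using InfSOP_bisimulation_run[OF bisim nts(1)] by blast
  \<comment> \<open>Maximality needs the backward direction: if \<open>ys\<close> could be extended
    under \<open>\<alpha> ! k\<close>, the converse bisimulation would extend \<open>xs\<close> too.
    So \<open>ys\<close> is stuck whenever \<open>xs\<close> is; if
    \<open>k = length \<alpha>\<close>, maximality is immediate.\<close>
  have "(ys ! k, xs ! k) \<in> R\<inverse>"
    using rel by simp
  then have "\<exists>x'. (xs ! k, \<alpha> ! k, x') \<in> trans \<Sigma>1" if "(ys ! k, \<alpha> ! k, y') \<in> trans \<Sigma>2" for y'
    using InfSOP_bisimulation_step[OF InfSOP_bisimulation_converse[OF bisim inputs] nts(2)] that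
    by blast
  then have "maximal_run_over \<Sigma>2 \<alpha> k ys"
    using max ys unfolding maximal_run_over_def by blast
  moreover have "outmap \<Sigma>1 (xs ! j) = outmap \<Sigma>2 (ys ! j)" if "j \<le> k" for j
    using bisim rel[OF that] unfolding InfSOP_bisimulation_def by blast
  ultimately show thesis using that sec by blast
qed

lemma InfSOP_bisimulation_opaque:
  assumes bisim: "InfSOP_bisimulation \<Sigma>1 \<Sigma>2 R" and nts: "is_nts \<Sigma>1" "is_nts \<Sigma>2"
    and inputs: "inputs \<Sigma>1 = inputs \<Sigma>2" and opaque: "infinite_step_opaque \<Sigma>1"
  shows "infinite_step_opaque \<Sigma>2"
  unfolding infinite_step_opaque_def
proof (intro ballI allI impI)
  fix \<alpha> k ys i
  assume \<alpha>: "\<alpha> \<in> lists (inputs \<Sigma>2)" and ys: "maximal_run_over \<Sigma>2 \<alpha> k ys"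
    and i: "i \<le> k" and sec: "ys ! i \<in> secret \<Sigma>2"
  obtain xs where xs: "maximal_run_over \<Sigma>1 \<alpha> k xs"
      "\<And>j. j \<le> k \<Longrightarrow> outmap \<Sigma>2 (ys ! j) = outmap \<Sigma>1 (xs ! j)"
      "\<And>j. j \<le> k \<Longrightarrow> ys ! j \<in> secret \<Sigma>2 \<longleftrightarrow> xs ! j \<in> secret \<Sigma>1"
    using InfSOP_bisimulation_maximal_run[OF InfSOP_bisimulation_converse[OF bisim inputs]
        nts(2,1) inputs[symmetric] ys] by blast
  have "xs ! i \<in> secret \<Sigma>1"
    using xs(3)[OF i] sec by simp
  then obtain xs' where xs': "maximal_run_over \<Sigma>1 \<alpha> k xs'" "xs' ! i \<notin> secret \<Sigma>1"
      "\<forall>j\<le>k. outmap \<Sigma>1 (xs ! j) = outmap \<Sigma>1 (xs' ! j)"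
    using opaque \<alpha> xs(1) i inputs unfolding infinite_step_opaque_def by metis
  obtain ys' where "maximal_run_over \<Sigma>2 \<alpha> k ys'"
      "\<And>j. j \<le> k \<Longrightarrow> outmap \<Sigma>1 (xs' ! j) = outmap \<Sigma>2 (ys' ! j)"
      "\<And>j. j \<le> k \<Longrightarrow> xs' ! j \<in> secret \<Sigma>1 \<longleftrightarrow> ys' ! j \<in> secret \<Sigma>2"
    using InfSOP_bisimulation_maximal_run[OF bisim nts inputs xs'(1)] by blast
  \<comment> \<open>Outputs agree along the chain \<open>ys\<close>, \<open>xs\<close>,
    \<open>xs'\<close>, \<open>ys'\<close>, while non-secrecy at \<open>i\<close> passes from
    \<open>xs'\<close> to \<open>ys'\<close>.\<close>
  then show "\<exists>ys'. maximal_run_over \<Sigma>2 \<alpha> k ys' \<and> ys' ! i \<notin> secret \<Sigma>2 \<and>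
      (\<forall>j\<le>k. outmap \<Sigma>2 (ys ! j) = outmap \<Sigma>2 (ys' ! j))"
    using xs(2) xs'(2,3) i by (intro exI[of _ ys']) simp
qed

theorem theorem3p18:
  fixes \<Sigma>1 :: "('x1, 'u, 'y) nts" and \<Sigma>2 :: "('x2, 'u, 'y) nts"
  assumes "is_nts \<Sigma>1" and "is_nts \<Sigma>2"
    and "inputs \<Sigma>1 = inputs \<Sigma>2" and "outputs \<Sigma>1 = outputs \<Sigma>2"
    and "\<exists>R. InfSOP_bisimulation \<Sigma>1 \<Sigma>2 R"
  shows "infinite_step_opaque \<Sigma>1 \<longleftrightarrow> infinite_step_opaque \<Sigma>2"
proof -
  obtain R where R: "InfSOP_bisimulation \<Sigma>1 \<Sigma>2 R"
    using assms(5) by blast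
  show ?thesis
    \<comment> \<open>Opacity passes forward along \<open>R\<close> and backward along its
      converse.\<close>
    using InfSOP_bisimulation_opaque[OF R assms(1-3)]
      InfSOP_bisimulation_opaque[OF InfSOP_bisimulation_converse[OF R assms(3)]
        assms(2,1) assms(3)[symmetric]]
    by blast
qed

end
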